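(* Let $\nu\in(0,1]$, $c\in[-\nu,\infty)$ and $a\in\mathbb{R}$. Then $$c\,E(t,a,\nu,\nu+1,c,a)\;\geq\; c\,\frac{(t-a)^{(\nu)}}{\Gamma(\nu+1)}\qquad\text{for all } t\in\mathbb{N}_{a+\nu-1}.$$
   Context: For a real number $b$, $\mathbb{N}_b=\{b,b+1,b+2,\ldots\}$. The power function is defined by $$x^{(y)}=\frac{\Gamma(x+1)}{\Gamma(x+1-y)}\quad\text{for } x,\ x-y\in\mathbb{R}\setminus\{\ldots,-2,-1\},$$ and $x^{(y)}=0$ for $x\notin\mathbb{Z}^-$ and $x-y\in\mathbb{Z}^-$, where $\mathbb{Z}^-=\{\ldots,-2,-1\}$. For $t\in\mathbb{N}_{a+\nu-1}$ and real parameters $a,\nu,\beta,c,\lambda$, define (whenever the right-hand side makes sense) $$E(t,a,\nu,\beta,c,\lambda)=\sum_{k=a}^{t-(\nu-1)}\frac{c^{k-a}}{\Gamma((k-a)\nu+\beta)}\,\bigl(t-\lambda+(k-a)(\nu-1)\bigr)^{((k-a)\nu+\beta-1)},$$ where the sum runs over $k=a,a+1,\ldots,t-(\nu-1)$ (so $k-a$ is a nonnegative integer), and $c^{k-a}$ is an ordinary power (with $c^0=1$), while the parenthesized exponent denotes the power function above. *)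

theory Defs
  imports "HOL-Analysis.Gamma_Function"
begin

definition nat_shift :: "real \<Rightarrow> real set" where
  "nat_shift b = {b + real n | n. True}"

definition neg_Ints :: "real set" where
  "neg_Ints = {x \<in> \<int>. x < 0}"

text \<open>
  The power function $x^{(y)}$. It is left unspecified at the points \<open>x \<in> neg_Ints\<close>, where
  the mathematical definition assigns no value.
\<close>
definition gen_falling :: "real \<Rightarrow> real \<Rightarrow> real" where
  "gen_falling x y =
     (if x \<in> neg_Ints then undefined
      else if x - y \<in> neg_Ints then 0
      else Gamma (x + 1) / Gamma (x + 1 - y))"

text \<open>
  The sum over $k = a, a+1, \ldots, t-(\nu-1)$ is indexed by the natural number \<open>j = k - a\<close>,
  so that the power of \<open>c\<close> is an ordinary power even for negative \<open>c\<close>. The index set is always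
  finite, and is \<open>{0..n}\<close> for \<open>t = a + \<nu> - 1 + n\<close>.
\<close>
definition E_sum :: "real \<Rightarrow> real \<Rightarrow> real \<Rightarrow> real \<Rightarrow> real \<Rightarrow> real \<Rightarrow> real" where
  "E_sum t a \<nu> \<beta> c l =
     (\<Sum>j | a + real j \<le> t - (\<nu> - 1).
        c ^ j / Gamma (real j * \<nu> + \<beta>) *
        gen_falling (t - l + real j * (\<nu> - 1)) (real j * \<nu> + \<beta> - 1))"

end

theory Submission
  imports Defs "HOL-Computational_Algebra.Formal_Power_Series"
begin

text \<open>
  Put \<open>t = a + \<nu> - 1 + n\<close>. The summand \<open>k = a\<close> of \<open>E\<close> is exactly the right-hand side without
  its factor \<open>c\<close>, so the claim is that \<open>c\<close> times the sum of the other summands is nonnegative.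
  Multiplied by \<open>c\<close>, the summand with \<open>k - a + 1 = m\<close> is
  \<open>c\<^sup>m\<close> times the coefficient of \<open>z\<^bsup>n - m\<^esup>\<close> in \<open>(1 - z)\<^bsup>-(m \<nu> + 1)\<^esup>\<close>, that is, the coefficient
  of \<open>z\<^sup>n\<close> in \<open>(1 - z)\<^bsup>-1\<^esup> q\<^sup>m\<close>, where \<open>q = c z (1 - z)\<^bsup>-\<nu>\<^esup>\<close>
  (\<open>summand_eq_fps_nth\<close>).

  Summing the geometric series over \<open>m \<ge> 2\<close> gives
  \<open>(1 - z)\<^bsup>-1\<^esup> q\<^sup>2 / (1 - q) = c\<^sup>2 z\<^sup>2 (1 - z)\<^bsup>-1-\<nu>\<^esup> / ((1 - z)\<^sup>\<nu> - c z)\<close>.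
  For \<open>0 < \<nu> \<le> 1\<close> all coefficients of \<open>(1 - z)\<^sup>\<nu>\<close> beyond the constant one are nonpositive, and
  the linear one is \<open>-\<nu>\<close>. Hence \<open>c \<ge> -\<nu>\<close> is precisely the condition under which the denominator
  has the form \<open>1 - g\<close> with all coefficients of \<open>g\<close> nonnegative. Then \<open>1 / (1 - g)\<close>, and with
  it the whole product, has nonnegative coefficients (\<open>geometric_tail_nth_nonneg\<close>).
\<close>

unbundle no vec_syntax and fps_syntax

section \<open>Binomial series with negated argument\<close>

text \<open>The formal power series \<open>(1 - z)\<^bsup>-s\<^esup>\<close>.\<close>

definition neg_binomial :: "real \<Rightarrow> real fps" where
  "neg_binomial s = fps_binomial (- s) oo (- fps_X)"

lemma neg_binomial_nth: "neg_binomial s $ n = pochhammer s n / fact n"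
proof -
  have "neg_binomial s $ n = (-1) ^ n * ((- s) gchoose n)"
    by (simp add: neg_binomial_def fps_compose_uminus')
  also have "\<dots> = pochhammer s n / fact n"
    by (simp add: gbinomial_pochhammer flip: power_add mult_2)
  finally show ?thesis .
qed

lemma neg_binomial_mult: "neg_binomial s * neg_binomial t = neg_binomial (s + t)"
  by (simp add: neg_binomial_def fps_compose_mult_distrib[symmetric] fps_binomial_add_mult[symmetric])

lemma neg_binomial_0: "neg_binomial 0 = 1"
  by (rule fps_ext) (auto simp: neg_binomial_nth pochhammer_0_left)

lemma neg_binomial_power: "neg_binomial s ^ m = neg_binomial (real m * s)"
  by (induction m) (simp_all add: neg_binomial_0 neg_binomial_mult algebra_simps)

lemma neg_binomial_nth_nonneg: "0 \<le> s \<Longrightarrow> 0 \<le> neg_binomial s $ n"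
  by (cases "s = 0") (auto simp: neg_binomial_nth pochhammer_0_left intro!: divide_nonneg_pos pochhammer_nonneg)

text \<open>
  After the first factor \<open>-\<nu>\<close>, the remaining factors \<open>1 - \<nu>, 2 - \<nu>, \<dots>\<close> of the rising
  factorial are nonnegative.
\<close>
lemma neg_binomial_nth_nonpos:
  assumes "0 < \<nu>" "\<nu> \<le> 1" "0 < n"
  shows "neg_binomial (- \<nu>) $ n \<le> 0"
proof -
  obtain k where n: "n = Suc k"
    using \<open>0 < n\<close> gr0_implies_Suc by blast
  have "pochhammer (1 - \<nu>) k \<ge> 0"
    using assms by (cases "\<nu> = 1") (auto simp: pochhammer_0_left intro!: pochhammer_nonneg)
  then show ?thesis
    using assms unfolding neg_binomial_nth n pochhammer_rec
    by (simp add: divide_le_0_iff mult_le_0_iff add.commute)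
qed

section \<open>Power series with nonnegative coefficients\<close>

lemma fps_mult_nth_nonneg:
  fixes f g :: "real fps"
  assumes "\<And>i. 0 \<le> f $ i" "\<And>i. 0 \<le> g $ i"
  shows "0 \<le> (f * g) $ n"
  by (auto simp: fps_mult_nth intro!: sum_nonneg mult_nonneg_nonneg assms)

text \<open>
  Such an \<open>f\<close> is \<open>1 - g\<close> with nonnegative coefficients in \<open>g\<close>, and its inverse is
  \<open>1 + g + g\<^sup>2 + \<dots>\<close>. The recursion for the coefficients of the inverse shows this without
  an infinite sum.
\<close>
lemma fps_inverse_nth_nonneg:
  fixes f :: "real fps"
  assumes "f $ 0 = 1" "\<And>i. 0 < i \<Longrightarrow> f $ i \<le> 0"
  shows "0 \<le> inverse f $ n"
proof (induction n rule: less_induct)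
  case (less n)
  show ?case
  proof (cases "n = 0")
    case True
    then show ?thesis using assms by simp
  next
    case False
    have "(\<Sum>i = 1..n. f $ i * inverse f $ (n - i)) \<le> 0"
      using assms(2) less.IH False by (intro sum_nonpos mult_nonpos_nonneg) auto
    moreover have "(\<Sum>i = 0..n. f $ i * inverse f $ (n - i)) = 0"
      using inverse_mult_eq_1'[of f] assms(1) False
      by (simp flip: fps_mult_nth)
    ultimately show ?thesis
      using assms(1) by (simp add: sum.atLeast_Suc_atMost)
  qed
qed

lemma geometric_tail_mult:
  fixes q :: "'a :: comm_ring_1"
  shows "(\<Sum>j = 1..n. q ^ Suc j) * (1 - q) = q ^ 2 - q ^ (n + 2)"
proof (induction n)
  case (Suc n)
  have "(\<Sum>j = 1..Suc n. q ^ Suc j) * (1 - q)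
          = (\<Sum>j = 1..n. q ^ Suc j) * (1 - q) + q ^ (n + 2) * (1 - q)"
    by (simp add: distrib_right)
  also have "\<dots> = (q ^ 2 - q ^ (n + 2)) + q ^ (n + 2) * (1 - q)"
    by (simp only: Suc.IH)
  also have "\<dots> = q ^ 2 - q ^ (Suc n + 2)"
    by (simp add: algebra_simps)
  finally show ?case .
qed (simp add: numeral_2_eq_2)

section \<open>The generating function of the sum\<close>

text \<open>
  The truncation of the geometric series at \<open>m = n + 1\<close> changes only coefficients beyond the
  \<open>n\<close>-th one, because \<open>q\<close> is divisible by \<open>z\<close>.
\<close>
lemma geometric_tail_nth_nonneg:
  fixes \<nu> c :: real
  assumes "0 < \<nu>" "\<nu> \<le> 1" "- \<nu> \<le> c"
  defines "q \<equiv> fps_const c * fps_X * neg_binomial \<nu>"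
  shows "0 \<le> (neg_binomial 1 * (\<Sum>j = 1..n. q ^ Suc j)) $ n"
proof -
  define D where "D = neg_binomial (- \<nu>) - fps_const c * fps_X"
  define G where "G = inverse D"
  define S where "S = (\<Sum>j = 1..n. q ^ Suc j)"
  have D0: "D $ 0 = 1"
    by (simp add: D_def neg_binomial_nth)
  have Dneg: "D $ i \<le> 0" if "0 < i" for i
  proof (cases "i = 1")
    case True
    then show ?thesis
      using assms(3) by (simp add: D_def neg_binomial_nth)
  next
    case False
    then show ?thesis
      using neg_binomial_nth_nonpos[OF assms(1,2) that] that by (simp add: D_def)
  qed
  have DG: "D * G = 1"
    unfolding G_def using D0 by (intro inverse_mult_eq_1') simp
  have G_nonneg: "0 \<le> G $ i" for i
    unfolding G_def using D0 Dneg by (rule fps_inverse_nth_nonneg)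
  have cancel: "neg_binomial \<nu> * neg_binomial (- \<nu>) = 1"
    by (simp add: neg_binomial_mult neg_binomial_0)
  have one_minus_q: "1 - q = neg_binomial \<nu> * D"
    by (simp add: D_def q_def right_diff_distrib cancel mult_ac)
  have "S = S * (neg_binomial \<nu> * neg_binomial (- \<nu>)) * (D * G)"
    by (simp add: cancel DG)
  also have "\<dots> = S * (1 - q) * neg_binomial (- \<nu>) * G"
    by (simp add: one_minus_q mult_ac)
  also have "S * (1 - q) = q ^ 2 - q ^ (n + 2)"
    unfolding S_def by (rule geometric_tail_mult)
  finally have S: "S = (q ^ 2 - q ^ (n + 2)) * neg_binomial (- \<nu>) * G" .
  have q2: "q ^ 2 * neg_binomial (- \<nu>) = fps_const (c ^ 2) * fps_X ^ 2 * neg_binomial \<nu>"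
  proof -
    have "q ^ 2 * neg_binomial (- \<nu>) = (fps_const c * fps_X) ^ 2 * neg_binomial \<nu> *
            (neg_binomial \<nu> * neg_binomial (- \<nu>))"
      by (simp add: q_def power2_eq_square mult_ac)
    then show ?thesis
      by (simp add: cancel power_mult_distrib flip: fps_const_power)
  qed
  \<comment> \<open>\<open>H\<close> is the product for the full geometric series, and \<open>z\<^bsup>n + 2\<^esup> R\<close> the truncation error.\<close>
  define H where "H = fps_const (c ^ 2) * (fps_X ^ 2 * (neg_binomial (1 + \<nu>) * G))"
  define R where "R = fps_const (c ^ (n + 2)) * neg_binomial \<nu> ^ (n + 2) *
                       neg_binomial 1 * neg_binomial (- \<nu>) * G"
  have qn: "q ^ (n + 2) = fps_X ^ (n + 2) * (fps_const (c ^ (n + 2)) * neg_binomial \<nu> ^ (n + 2))"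
    unfolding q_def power_mult_distrib fps_const_power by (simp only: mult_ac)
  have "neg_binomial 1 * S =
          neg_binomial 1 * (q ^ 2 * neg_binomial (- \<nu>)) * G
          - neg_binomial 1 * q ^ (n + 2) * neg_binomial (- \<nu>) * G"
    unfolding S by (simp only: algebra_simps)
  also have "neg_binomial 1 * (q ^ 2 * neg_binomial (- \<nu>)) * G = H"
    unfolding q2 H_def neg_binomial_mult[symmetric] by (simp only: mult_ac)
  also have "neg_binomial 1 * q ^ (n + 2) * neg_binomial (- \<nu>) * G = fps_X ^ (n + 2) * R"
    unfolding qn R_def by (simp only: mult_ac)
  finally have "(neg_binomial 1 * S) $ n = H $ n - (fps_X ^ (n + 2) * R) $ n"
    by simp
  also have "(fps_X ^ (n + 2) * R) $ n = 0"
    by (simp only: fps_X_power_mult_nth) simp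
  finally have "(neg_binomial 1 * S) $ n = H $ n"
    by simp
  moreover have "0 \<le> H $ n"
    using assms(1) unfolding H_def
    by (simp add: fps_X_power_mult_nth fps_mult_nth_nonneg neg_binomial_nth_nonneg G_nonneg)
  ultimately show ?thesis
    by (simp add: S_def)
qed

lemma neg_Ints_le: "x \<in> neg_Ints \<Longrightarrow> x \<le> -1"
proof -
  assume "x \<in> neg_Ints"
  then have "x \<in> \<int>" "x < 0"
    by (simp_all add: neg_Ints_def)
  then obtain z where "x = of_int z" "z < 0"
    by (auto elim!: Ints_cases)
  then show ?thesis
    by linarith
qed

text \<open>
  The Gamma quotient is the binomial coefficient of a negative power of \<open>1 - z\<close>. The case
  \<open>j = n\<close>, where the power function vanishes by convention, matches too: there \<open>z\<^bsup>n + 1\<^esup>\<close>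
  divides the series.
\<close>
lemma summand_eq_fps_nth:
  fixes \<nu> c :: real
  assumes "0 < \<nu>" "j \<le> n"
  defines "q \<equiv> fps_const c * fps_X * neg_binomial \<nu>"
  shows "c * (c ^ j / Gamma (real j * \<nu> + (\<nu> + 1)) *
           gen_falling (\<nu> - 1 + real n + real j * (\<nu> - 1)) (real j * \<nu> + (\<nu> + 1) - 1))
         = (neg_binomial 1 * q ^ Suc j) $ n"
proof -
  define s where "s = real (Suc j) * \<nu>"
  have s_pos: "0 < s"
    using assms(1) by (simp add: s_def)
  have args: "real j * \<nu> + (\<nu> + 1) = s + 1"
    "\<nu> - 1 + real n + real j * (\<nu> - 1) = s + (real n - real j) - 1"
    by (simp_all add: s_def algebra_simps)
  have defined: "s + (real n - real j) - 1 \<notin> neg_Ints"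
    using s_pos assms(2) by (auto dest: neg_Ints_le)
  have "q ^ Suc j = fps_X ^ Suc j * (fps_const (c ^ Suc j) * neg_binomial s)"
    unfolding q_def s_def power_mult_distrib fps_const_power neg_binomial_power
    by (simp only: mult_ac)
  then have series: "neg_binomial 1 * q ^ Suc j =
      fps_const (c ^ Suc j) * (fps_X ^ Suc j * neg_binomial (s + 1))"
    unfolding neg_binomial_mult[symmetric] by (simp only: mult_ac)
  show ?thesis
  proof (cases "j = n")
    case True
    have "(-1::real) \<in> neg_Ints"
      by (simp add: neg_Ints_def)
    then show ?thesis
      using defined True unfolding args series
      by (simp add: gen_falling_def fps_X_power_mult_nth del: power_Suc)
  next
    case False
    define k where "k = n - Suc j"
    have n: "n = Suc j + k"
      using False assms(2) by (simp add: k_def)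
    have k: "s + (real n - real j) - 1 = s + real k"
      by (simp add: n)
    have "s + real k - s \<notin> neg_Ints"
      by (simp add: neg_Ints_def)
    then have "gen_falling (s + real k) s = Gamma (s + real k + 1) / fact k"
      using defined by (simp add: k gen_falling_def Gamma_fact add.commute)
    also have "\<dots> / Gamma (s + 1) = neg_binomial (s + 1) $ k"
    proof -
      have "s + 1 \<notin> \<int>\<^sub>\<le>\<^sub>0"
        using s_pos by (auto elim!: nonpos_Ints_cases)
      then show ?thesis
        by (simp add: neg_binomial_nth pochhammer_Gamma add_ac)
    qed
    finally have coeff: "gen_falling (s + real k) s / Gamma (s + 1) = neg_binomial (s + 1) $ k" .
    have "(neg_binomial 1 * q ^ Suc j) $ n = c ^ Suc j * neg_binomial (s + 1) $ k"
      unfolding series by (simp add: fps_X_power_mult_nth n del: power_Suc)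
    then show ?thesis
      unfolding args k coeff[symmetric] by simp
  qed
qed

section \<open>The inequality\<close>

theorem theorem3p6:
  fixes \<nu> c a :: real
  assumes "0 < \<nu>" and "\<nu> \<le> 1" and "- \<nu> \<le> c"
  shows "\<forall>t \<in> nat_shift (a + \<nu> - 1).
           c * E_sum t a \<nu> (\<nu> + 1) c a \<ge> c * (gen_falling (t - a) \<nu> / Gamma (\<nu> + 1))"
proof
  fix t assume "t \<in> nat_shift (a + \<nu> - 1)"
  then obtain n where t: "t = a + \<nu> - 1 + real n"
    by (auto simp: nat_shift_def)
  define q where "q = fps_const c * fps_X * neg_binomial \<nu>"
  define f where "f j = c ^ j / Gamma (real j * \<nu> + (\<nu> + 1)) *
    gen_falling (t - a + real j * (\<nu> - 1)) (real j * \<nu> + (\<nu> + 1) - 1)" for j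
  have f: "c * f j = (neg_binomial 1 * q ^ Suc j) $ n" if "j \<le> n" for j
  proof -
    have "t - a = \<nu> - 1 + real n"
      by (simp add: t)
    then show ?thesis
      unfolding f_def q_def by (simp only: summand_eq_fps_nth[OF assms(1) that])
  qed
  have index: "{j. a + real j \<le> t - (\<nu> - 1)} = {0..n}"
    by (auto simp: t)
  have "c * E_sum t a \<nu> (\<nu> + 1) c a = c * f 0 + (\<Sum>j = 1..n. c * f j)"
    unfolding E_sum_def index f_def[symmetric]
    by (simp add: sum.atLeast_Suc_atMost sum_distrib_left distrib_left)
  also have "c * f 0 = c * (gen_falling (t - a) \<nu> / Gamma (\<nu> + 1))"
    by (simp add: f_def)
  also have "(\<Sum>j = 1..n. c * f j) = (neg_binomial 1 * (\<Sum>j = 1..n. q ^ Suc j)) $ n"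
    unfolding sum_distrib_left fps_sum_nth by (rule sum.cong) (simp_all only: f atLeastAtMost_iff)
  finally show "c * E_sum t a \<nu> (\<nu> + 1) c a \<ge> c * (gen_falling (t - a) \<nu> / Gamma (\<nu> + 1))"
    using geometric_tail_nth_nonneg[OF assms, of n] by (simp add: q_def)
qed

end
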